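(* Let $d\ge 2$ be an integer, let $\mu$ be the normalized Haar measure on the unitary group $\mathsf{U}(d)$, and let $A\in M_{d^2}(\mathbb{C})$, regarded as an operator on $\mathbb{C}^d\otimes\mathbb{C}^d$. Let $F$ be the swap operator on $\mathbb{C}^d\otimes\mathbb{C}^d$, defined by $F|ij\rangle=|ji\rangle$ for all $i,j=1,\dots,d$. Then $$\int_{\mathsf{U}(d)}(U\otimes U)A(U\otimes U)^\dagger\, d\mu(U) = \left(\frac{\operatorname{Tr}(A)}{d^2-1} - \frac{\operatorname{Tr}(AF)}{d(d^2-1)}\right)I_{d^2} - \left(\frac{\operatorname{Tr}(A)}{d(d^2-1)}- \frac{\operatorname{Tr}(AF)}{d^2-1}\right)F.$$
   Context: $\mathsf{U}(d)$ is the group of $d\times d$ complex unitary matrices; $^\dagger$ is the conjugate transpose; $I_{d^2}$ is the identity on $\mathbb{C}^d\otimes\mathbb{C}^d$; $\{|i\rangle\}_{i=1}^d$ is the standard basis of $\mathbb{C}^d$ and $|ij\rangle=|i\rangle\otimes|j\rangle$. Integrals of operator-valued functions are taken entrywise. *)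

theory Defs
  imports "HOL-Probability.Probability"
begin

text \<open>
  The standard basis of \<open>\<complex>\<^sup>d\<close> is indexed by a finite type \<open>'n\<close> with \<open>d = CARD('n)\<close>, and
  \<open>\<complex>\<^sup>d \<otimes> \<complex>\<^sup>d\<close> is \<open>complex ^ ('n \<times> 'n)\<close>, whose basis vector \<open>axis (i, j) 1\<close> is \<open>|ij\<rangle>\<close>.
\<close>

definition conj_transpose :: "complex ^ 'n ^ 'm \<Rightarrow> complex ^ 'm ^ 'n"
  (\<open>_\<^sup>\<dagger>\<close> [1000] 999)
  where "A\<^sup>\<dagger> = map_matrix cnj (transpose A)"

definition unitary_group :: "(complex ^ 'n ^ 'n) set"
  where "unitary_group = {U. U ** U\<^sup>\<dagger> = mat 1 \<and> U\<^sup>\<dagger> ** U = mat 1}"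

definition tensor_vec :: "complex ^ 'n \<Rightarrow> complex ^ 'm \<Rightarrow> complex ^ ('n::finite \<times> 'm::finite)"
  (infixr \<open>\<otimes>\<^sub>v\<close> 75)
  where "x \<otimes>\<^sub>v y = (\<chi> p. x $ fst p * y $ snd p)"

definition tensor_mat ::
    "complex ^ 'n ^ 'n \<Rightarrow> complex ^ 'm ^ 'm \<Rightarrow> complex ^ ('n::finite \<times> 'm::finite) ^ ('n \<times> 'm)"
  (infixr \<open>\<otimes>\<^sub>m\<close> 75)
  where "A \<otimes>\<^sub>m B = (\<chi> p q. A $ fst p $ fst q * B $ snd p $ snd q)"

definition swap_operator :: "complex ^ ('n::finite \<times> 'n) ^ ('n \<times> 'n)"
  where "swap_operator = (\<chi> p q. if p = prod.swap q then 1 else 0)"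

definition smult_mat :: "complex \<Rightarrow> complex ^ 'n ^ 'm \<Rightarrow> complex ^ 'n ^ 'm"
  (infixr \<open>*\<^sub>m\<close> 75)
  where "c *\<^sub>m A = map_matrix ((*) c) A"

definition entrywise_integral ::
    "'a measure \<Rightarrow> ('a \<Rightarrow> complex ^ 'n ^ 'm) \<Rightarrow> complex ^ 'n ^ 'm"
  where "entrywise_integral M f = (\<chi> i j. \<integral>x. f x $ i $ j \<partial>M)"

text \<open>
  The normalized Haar measure is the left-invariant Borel probability measure on the unitary group.
  Regularity is not listed: the group is compact and metrizable, so every finite Borel measure on it
  is regular. Right invariance follows from left invariance because the group is compact.
\<close>

definition normalized_haar_measure :: "(complex ^ 'n ^ 'n) measure \<Rightarrow> bool"
  where "normalized_haar_measure \<mu> \<longleftrightarrow>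
    prob_space \<mu> \<and>
    sets \<mu> = sets (restrict_space borel unitary_group) \<and>
    (\<forall>V\<in>unitary_group. \<forall>B\<in>sets \<mu>. emeasure \<mu> ((\<lambda>U. V ** U) ` B) = emeasure \<mu> B)"

lemma axis_tensor_vec: "axis i 1 \<otimes>\<^sub>v axis j 1 = axis (i, j) 1"
  by (auto simp: tensor_vec_def axis_def vec_eq_iff)

lemma tensor_mat_mult_tensor_vec: "(A \<otimes>\<^sub>m B) *v (x \<otimes>\<^sub>v y) = (A *v x) \<otimes>\<^sub>v (B *v y)"
  by (simp add: tensor_mat_def tensor_vec_def matrix_vector_mult_def vec_eq_iff sum_product
      sum.cartesian_product UNIV_Times_UNIV[symmetric] case_prod_unfold mult_ac
      del: UNIV_Times_UNIV)

lemma swap_operator_basis: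
  "swap_operator *v (axis i 1 \<otimes>\<^sub>v axis j 1) = axis j 1 \<otimes>\<^sub>v axis i 1"
  unfolding axis_tensor_vec
  by (auto simp: swap_operator_def matrix_vector_mult_def vec_eq_iff axis_def
      if_distrib[of "\<lambda>x. _ * x"] cong: if_cong)

end

theory Submission
  imports Defs
begin

text \<open>
  By left invariance, the twirl \<open>T\<close> of \<open>A\<close> commutes with \<open>V \<otimes> V\<close> for every unitary \<open>V\<close>. Testing this
  with diagonal phases, permutation matrices and a Hadamard matrix on two coordinates forces
  \<open>T = a I + b F\<close>. As twirling preserves the trace and the trace against \<open>F\<close>, the coefficients
  solve \<open>a d\<^sup>2 + b d = Tr A\<close> and \<open>a d + b d\<^sup>2 = Tr (A F)\<close>.
\<close>

section \<open>Unitary matrices and tensor products\<close>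

lemma conj_transpose_nth [simp]: "A\<^sup>\<dagger> $ i $ j = cnj (A $ j $ i)"
  by (simp add: conj_transpose_def map_matrix_def transpose_def)

lemma tensor_mat_nth [simp]: "(A \<otimes>\<^sub>m B) $ p $ q = A $ fst p $ fst q * B $ snd p $ snd q"
  by (simp add: tensor_mat_def)

lemma smult_mat_nth [simp]: "(c *\<^sub>m A) $ i $ j = c * A $ i $ j"
  by (simp add: smult_mat_def map_matrix_def)

lemma swap_operator_nth [simp]: "swap_operator $ p $ q = (if p = prod.swap q then 1 else 0)"
  by (simp add: swap_operator_def)

lemma mat_nth: "mat c $ i $ j = (if i = j then c else 0)"
  by (simp add: mat_def)

lemma matrix_mult_nth: "(A ** B) $ i $ j = (\<Sum>k\<in>UNIV. A $ i $ k * B $ k $ j)"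
  by (simp add: matrix_matrix_mult_def)

lemma conj_transpose_conj_transpose [simp]: "(A\<^sup>\<dagger>)\<^sup>\<dagger> = A"
  by (simp add: vec_eq_iff)

lemma conj_transpose_mult: "(A ** B)\<^sup>\<dagger> = B\<^sup>\<dagger> ** A\<^sup>\<dagger>"
  by (simp add: vec_eq_iff matrix_mult_nth mult.commute)

lemma tensor_mat_mult: "(A \<otimes>\<^sub>m B) ** (C \<otimes>\<^sub>m D) = (A ** C) \<otimes>\<^sub>m (B ** D)"
  by (simp add: vec_eq_iff matrix_mult_nth sum_product sum.cartesian_product
      UNIV_Times_UNIV[symmetric] case_prod_unfold mult_ac del: UNIV_Times_UNIV)

lemma conj_transpose_tensor_mat: "(A \<otimes>\<^sub>m B)\<^sup>\<dagger> = A\<^sup>\<dagger> \<otimes>\<^sub>m B\<^sup>\<dagger>"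
  by (simp add: vec_eq_iff)

lemma tensor_mat_one: "mat 1 \<otimes>\<^sub>m mat 1 = mat 1"
  by (auto simp: vec_eq_iff mat_nth prod_eq_iff)

lemma unitary_groupD:
  assumes "U \<in> unitary_group"
  shows "U ** U\<^sup>\<dagger> = mat 1" "U\<^sup>\<dagger> ** U = mat 1"
  using assms by (auto simp: unitary_group_def)

text \<open>A one-sided inverse of a square matrix is two-sided, so later unitarity proofs check
  only one product.\<close>

lemma unitary_groupI:
  fixes U :: "complex ^ 'n::finite ^ 'n"
  assumes "U ** U\<^sup>\<dagger> = mat 1"
  shows "U \<in> unitary_group"
  using assms matrix_left_right_inverse[of U "U\<^sup>\<dagger>"] by (simp add: unitary_group_def)

lemma conj_transpose_unitary: "U \<in> unitary_group \<Longrightarrow> U\<^sup>\<dagger> \<in> unitary_group"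
  by (auto simp: unitary_group_def)

lemma unitary_mult:
  fixes U V :: "complex ^ 'n::finite ^ 'n"
  assumes "U \<in> unitary_group" "V \<in> unitary_group"
  shows "U ** V \<in> unitary_group"
proof (rule unitary_groupI)
  have "(U ** V) ** (U ** V)\<^sup>\<dagger> = U ** (V ** V\<^sup>\<dagger>) ** U\<^sup>\<dagger>"
    by (simp add: conj_transpose_mult matrix_mul_assoc)
  then show "(U ** V) ** (U ** V)\<^sup>\<dagger> = mat 1"
    by (simp add: unitary_groupD assms)
qed

lemma tensor_mat_unitary:
  fixes U :: "complex ^ 'n::finite ^ 'n" and V :: "complex ^ 'm::finite ^ 'm"
  assumes "U \<in> unitary_group" "V \<in> unitary_group"
  shows "U \<otimes>\<^sub>m V \<in> unitary_group"
  by (rule unitary_groupI)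
    (simp add: conj_transpose_tensor_mat tensor_mat_mult unitary_groupD assms tensor_mat_one)

section \<open>Compactness of the unitary group\<close>

lemma norm_unitary_nth_le:
  fixes U :: "complex ^ 'n::finite ^ 'n"
  assumes "U \<in> unitary_group"
  shows "norm (U $ i $ j) \<le> 1"
proof -
  \<comment> \<open>The diagonal entries of \<open>U ** U\<^sup>\<dagger>\<close> are the squared
    lengths of the rows, so every row is a unit vector.\<close>
  have "(\<Sum>k\<in>UNIV. U $ i $ k * cnj (U $ i $ k)) = 1"
    using unitary_groupD(1)[OF assms] by (simp add: vec_eq_iff matrix_mult_nth mat_nth)
  then have "of_real (\<Sum>k\<in>UNIV. (norm (U $ i $ k))\<^sup>2) = (1 :: complex)"
    by (simp only: of_real_sum complex_norm_square)
  then have "(\<Sum>k\<in>UNIV. (norm (U $ i $ k))\<^sup>2) = 1"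
    using of_real_eq_1_iff by blast
  moreover have "(norm (U $ i $ j))\<^sup>2 \<le> (\<Sum>k\<in>UNIV. (norm (U $ i $ k))\<^sup>2)"
    by (rule member_le_sum) auto
  ultimately show ?thesis
    by (metis abs_norm_cancel abs_square_le_1)
qed

text \<open>The entry bound gives boundedness, and the defining equations are continuous in the
  entries, which gives closedness. Compactness later makes continuous integrands bounded.\<close>

lemma compact_unitary_group: "compact (unitary_group :: (complex ^ 'n::finite ^ 'n) set)"
proof -
  have "bounded (unitary_group :: (complex ^ 'n ^ 'n) set)"
  proof (rule boundedI)
    fix U :: "complex ^ 'n ^ 'n"
    assume U: "U \<in> unitary_group"
    have "norm (U $ i) \<le> CARD('n)" for i
    proof -
      have "norm (U $ i) \<le> (\<Sum>j\<in>UNIV. norm (U $ i $ j))"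
        unfolding norm_vec_def by (rule L2_set_le_sum) auto
      also have "\<dots> \<le> (\<Sum>j\<in>(UNIV :: 'n set). 1)"
        by (intro sum_mono norm_unitary_nth_le U)
      finally show ?thesis by simp
    qed
    moreover have "norm U \<le> (\<Sum>i\<in>UNIV. norm (U $ i))"
      unfolding norm_vec_def[of U] by (rule L2_set_le_sum) auto
    ultimately show "norm U \<le> (\<Sum>i\<in>(UNIV :: 'n set). real CARD('n))"
      by (meson order_trans sum_mono)
  qed
  moreover have "closed (unitary_group :: (complex ^ 'n ^ 'n) set)"
    unfolding unitary_group_def vec_eq_iff matrix_mult_nth conj_transpose_nth
    by (intro closed_Collect_conj closed_Collect_all closed_Collect_eq continuous_intros)
  ultimately show ?thesis
    by (simp add: compact_eq_bounded_closed)
qed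

section \<open>The swap operator and traces\<close>

lemma swap_operator_mult_nth: "(swap_operator ** A) $ p $ q = A $ prod.swap p $ q"
proof -
  have "(swap_operator ** A) $ p $ q = (\<Sum>r\<in>UNIV. if r = prod.swap p then A $ r $ q else 0)"
    unfolding matrix_mult_nth by (intro sum.cong) auto
  then show ?thesis by simp
qed

lemma mult_swap_operator_nth: "(A ** swap_operator) $ p $ q = A $ p $ prod.swap q"
proof -
  have "(A ** swap_operator) $ p $ q = (\<Sum>r\<in>UNIV. if r = prod.swap q then A $ p $ r else 0)"
    unfolding matrix_mult_nth by (intro sum.cong) auto
  then show ?thesis by simp
qed

text \<open>Exchanging two equal tensor factors changes nothing. This makes the swap an admissible
  test matrix in \<open>trace_twirl_mult\<close>.\<close>

lemma swap_operator_commutes_tensor: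
  "swap_operator ** (U \<otimes>\<^sub>m U) = (U \<otimes>\<^sub>m U) ** swap_operator"
  by (simp add: vec_eq_iff swap_operator_mult_nth mult_swap_operator_nth mult.commute)

lemma trace_mat_one: "trace (mat 1 :: complex ^ 'n::finite ^ 'n) = of_nat CARD('n)"
  by (simp add: trace_def mat_nth)

text \<open>The trace of a permutation matrix counts fixed points; here these are the pairs with
  equal components.\<close>

lemma trace_swap_operator:
  "trace (swap_operator :: complex ^ ('n::finite \<times> 'n) ^ ('n \<times> 'n)) = of_nat CARD('n)"
proof -
  have "trace (swap_operator :: complex ^ ('n \<times> 'n) ^ ('n \<times> 'n)) =
      (\<Sum>(i, j)\<in>UNIV \<times> UNIV. if i = (j :: 'n) then 1 else 0)"
    unfolding trace_def by (intro sum.cong) (auto simp: prod_eq_iff case_prod_unfold)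
  also have "\<dots> = (\<Sum>i\<in>UNIV. \<Sum>j\<in>UNIV. if i = (j :: 'n) then 1 else 0)"
    by (rule sum.cartesian_product[symmetric])
  finally show ?thesis
    by simp
qed

lemma trace_add_smult:
  "trace (a *\<^sub>m A + b *\<^sub>m B) = a * trace A + b * trace B"
  by (simp add: trace_def sum.distrib sum_distrib_left)

lemma trace_unitary_conj:
  fixes U :: "complex ^ 'n::finite ^ 'n"
  assumes "U \<in> unitary_group"
  shows "trace (U ** A ** U\<^sup>\<dagger>) = trace A"
proof -
  have "trace (U ** A ** U\<^sup>\<dagger>) = trace (U\<^sup>\<dagger> ** U ** A)"
    by (metis matrix_mul_assoc trace_mul_sym)
  then show ?thesis
    by (simp add: unitary_groupD assms)
qed

section \<open>The commutant of the tensor squares\<close>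

lemma diagonal_unitary:
  fixes v :: "'n::finite \<Rightarrow> complex"
  assumes "\<And>i. norm (v i) = 1"
  shows "(\<chi> i j. if i = j then v i else 0) \<in> unitary_group"
proof (rule unitary_groupI, unfold vec_eq_iff matrix_mult_nth conj_transpose_nth, intro allI)
  fix i j :: 'n
  have "(\<Sum>k\<in>UNIV. (\<chi> i j. if i = j then v i else 0) $ i $ k *
      cnj ((\<chi> i j. if i = j then v i else 0) $ j $ k)) =
      (\<Sum>k\<in>UNIV. if k = i then (if i = j then v i * cnj (v i) else 0) else 0)"
    by (intro sum.cong) auto
  then show "(\<Sum>k\<in>UNIV. (\<chi> i j. if i = j then v i else 0) $ i $ k *
      cnj ((\<chi> i j. if i = j then v i else 0) $ j $ k)) = mat 1 $ i $ j"
    by (simp add: mat_nth assms flip: complex_norm_square)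
qed

lemma permutation_unitary:
  fixes \<pi> :: "'n::finite \<Rightarrow> 'n"
  assumes "bij \<pi>"
  shows "(\<chi> i j. if i = \<pi> j then 1 else 0) \<in> unitary_group"
proof (rule unitary_groupI, unfold vec_eq_iff matrix_mult_nth conj_transpose_nth, intro allI)
  fix i j :: 'n
  have "(\<Sum>k\<in>UNIV. (\<chi> i j. if i = \<pi> j then 1 else 0) $ i $ k *
      cnj ((\<chi> i j. if i = \<pi> j then 1 else 0) $ j $ k)) =
      (\<Sum>k\<in>UNIV. if k = inv \<pi> i then (if i = j then 1 else 0) else 0)"
    using assms by (intro sum.cong) (auto simp: bij_inv_eq_iff)
  then show "(\<Sum>k\<in>UNIV. (\<chi> i j. if i = \<pi> j then 1 else 0) $ i $ k *
      cnj ((\<chi> i j. if i = \<pi> j then 1 else 0) $ j $ k)) = mat 1 $ i $ j"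
    by (simp add: mat_nth)
qed

text \<open>Phases and permutations give no link between the entry of \<open>T\<close> at
  \<open>(x, x)\<close>, \<open>(x, x)\<close> and the entries indexed by \<open>(x, y)\<close> and
  \<open>(y, x)\<close>. A unitary that mixes the two basis vectors supplies it.\<close>

definition hadamard_on :: "'n \<Rightarrow> 'n \<Rightarrow> complex ^ 'n ^ 'n"
  where "hadamard_on x y = (\<chi> i j.
    if i \<in> {x, y} \<and> j \<in> {x, y} then (if i = y \<and> j = y then - 1 else 1) / sqrt 2
    else if i = j then 1 else 0)"

lemma hadamard_on_unitary:
  fixes x y :: "'n::finite"
  assumes "x \<noteq> y"
  shows "hadamard_on x y \<in> unitary_group"
proof (rule unitary_groupI, unfold vec_eq_iff matrix_mult_nth conj_transpose_nth, intro allI)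
  fix i j :: 'n
  let ?H = "hadamard_on x y"
  have s: "complex_of_real (sqrt 2) * complex_of_real (sqrt 2) = 2"
    by (simp flip: of_real_mult)
  \<comment> \<open>Columns \<open>x\<close> and \<open>y\<close> carry the 2 by 2 block; in all
    other columns the matrix agrees with the identity.\<close>
  have split: "(\<Sum>k\<in>UNIV. ?H $ i $ k * cnj (?H $ j $ k)) =
      ?H $ i $ x * cnj (?H $ j $ x) + ?H $ i $ y * cnj (?H $ j $ y) +
      (\<Sum>k\<in>UNIV - {x, y}. ?H $ i $ k * cnj (?H $ j $ k))"
    using assms sum.subset_diff[of "{x, y}" UNIV "\<lambda>k. ?H $ i $ k * cnj (?H $ j $ k)"]
    by (simp add: add_ac)
  have "(\<Sum>k\<in>UNIV - {x, y}. ?H $ i $ k * cnj (?H $ j $ k)) =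
      (\<Sum>k\<in>UNIV - {x, y}. if k = i then (if i = j then 1 else 0) else 0)"
    by (intro sum.cong) (auto simp: hadamard_on_def)
  also have "\<dots> = (if i = j \<and> i \<notin> {x, y} then 1 else 0)"
    by (simp add: sum.delta)
  finally show "(\<Sum>k\<in>UNIV. ?H $ i $ k * cnj (?H $ j $ k)) = mat 1 $ i $ j"
    unfolding split using assms by (auto simp: hadamard_on_def mat_nth s)
qed

text \<open>Double transitivity of the symmetric group.\<close>

lemma ex_bij_pair:
  fixes i j k l :: 'n
  assumes "i \<noteq> j" "k \<noteq> l"
  obtains \<pi> :: "'n \<Rightarrow> 'n" where "bij \<pi>" "\<pi> i = k" "\<pi> j = l"
proof
  \<comment> \<open>The inner transposition sends \<open>i\<close> to \<open>k\<close>. The outer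
    one sends the image of \<open>j\<close> to \<open>l\<close> and fixes \<open>k\<close>, since
    neither that image nor \<open>l\<close> equals \<open>k\<close>.\<close>
  let ?\<pi> = "Transposition.transpose (Transposition.transpose i k j) l \<circ> Transposition.transpose i k"
  show "bij ?\<pi>" by (intro bij_comp bij_transpose)
  show "?\<pi> i = k" "?\<pi> j = l"
    using assms by (auto simp: Transposition.transpose_def)
qed

text \<open>Put the phase \<i> at one coordinate \<open>x\<close> and 1 elsewhere. The product over
  a pair is then 1, \<i> or -1 according to how often \<open>x\<close> occurs in it, and pairs that
  differ as multisets differ in some multiplicity.\<close>

lemma ex_separating_phase:
  assumes "(i, j) \<noteq> (k, l)" "(i, j) \<noteq> (l, k)"
  obtains v :: "'n \<Rightarrow> complex" where "\<And>m. norm (v m) = 1" "v i * v j \<noteq> v k * v l"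
proof -
  define v where "v x m = (if m = x then \<i> else 1)" for x m :: 'n
  have "norm (v x m) = 1" for x m by (simp add: v_def)
  moreover have "\<exists>x. v x i * v x j \<noteq> v x k * v x l"
  proof (cases "i = k \<or> i = l")
    case True
    \<comment> \<open>After cancelling the common element, \<open>j\<close> differs from what
      remains of the other pair, so \<open>j\<close> occurs once more in
      \<open>(i, j)\<close>.\<close>
    then show ?thesis
      using assms by (intro exI[of _ j]) (auto simp: v_def complex_eq_iff)
  next
    case False
    then show ?thesis
      by (intro exI[of _ i]) (auto simp: v_def complex_eq_iff)
  qed
  ultimately show ?thesis using that by blast
qed

text \<open>Schur-Weyl duality for two tensor factors, obtained by comparing entries.\<close>

lemma commutant_tensor_square:
  fixes T :: "complex ^ ('n::finite \<times> 'n) ^ ('n \<times> 'n)"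
  assumes comm: "\<And>V. V \<in> unitary_group \<Longrightarrow> (V \<otimes>\<^sub>m V) ** T = T ** (V \<otimes>\<^sub>m V)"
  obtains a b where "T = a *\<^sub>m mat 1 + b *\<^sub>m swap_operator"
proof -
  have comm_nth: "(\<Sum>r\<in>UNIV. V $ i $ fst r * V $ j $ snd r * T $ r $ (k, l)) =
      (\<Sum>r\<in>UNIV. T $ (i, j) $ r * (V $ fst r $ k * V $ snd r $ l))"
    if "V \<in> unitary_group" for V i j k l
    using comm[OF that] by (simp add: vec_eq_iff matrix_mult_nth)
  \<comment> \<open>A diagonal \<open>V\<close> scales this entry by \<open>v i * v j\<close> from
    the left and by \<open>v k * v l\<close> from the right; unequal scalars force it to
    vanish.\<close>
  have zero: "T $ (i, j) $ (k, l) = 0" if "(i, j) \<noteq> (k, l)" "(i, j) \<noteq> (l, k)" for i j k l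
  proof -
    obtain v :: "'n \<Rightarrow> complex" where v: "\<And>m. norm (v m) = 1" "v i * v j \<noteq> v k * v l"
      using ex_separating_phase[OF \<open>(i, j) \<noteq> (k, l)\<close> \<open>(i, j) \<noteq> (l, k)\<close>] by metis
    let ?V = "\<chi> i j. if i = j then v i else 0"
    have "(\<Sum>r\<in>UNIV. ?V $ i $ fst r * ?V $ j $ snd r * T $ r $ (k, l)) =
        (\<Sum>r\<in>UNIV. if r = (i, j) then v i * v j * T $ r $ (k, l) else 0)"
      by (intro sum.cong) auto
    moreover have "(\<Sum>r\<in>UNIV. T $ (i, j) $ r * (?V $ fst r $ k * ?V $ snd r $ l)) =
        (\<Sum>r\<in>UNIV. if r = (k, l) then T $ (i, j) $ r * (v k * v l) else 0)"
      by (intro sum.cong) auto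
    ultimately have "v i * v j * T $ (i, j) $ (k, l) = T $ (i, j) $ (k, l) * (v k * v l)"
      using comm_nth[OF diagonal_unitary[of v, OF v(1)], of i j k l] by simp
    then show ?thesis using v(2) by (auto simp: mult.commute)
  qed
  \<comment> \<open>A permutation matrix relabels the indices, so an entry depends only on the
    pattern of equalities among them.\<close>
  have perm: "T $ (\<pi> i, \<pi> j) $ (\<pi> k, \<pi> l) = T $ (i, j) $ (k, l)" if "bij \<pi>" for \<pi> i j k l
  proof -
    let ?V = "\<chi> i j. if i = \<pi> j then 1 else 0"
    have "(\<Sum>r\<in>UNIV. ?V $ \<pi> i $ fst r * ?V $ \<pi> j $ snd r * T $ r $ (k, l)) =
        (\<Sum>r\<in>UNIV. if r = (i, j) then T $ r $ (k, l) else 0)"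
      using bij_is_inj[OF that] by (intro sum.cong) (auto simp: inj_eq)
    moreover have "(\<Sum>r\<in>UNIV. T $ (\<pi> i, \<pi> j) $ r * (?V $ fst r $ k * ?V $ snd r $ l)) =
        (\<Sum>r\<in>UNIV. if r = (\<pi> k, \<pi> l) then T $ (\<pi> i, \<pi> j) $ r else 0)"
      by (intro sum.cong) auto
    ultimately show ?thesis
      using comm_nth[OF permutation_unitary[OF that], of "\<pi> i" "\<pi> j" k l] by simp
  qed
  \<comment> \<open>Compare the commutation relation in row \<open>(x, x)\<close> and column
    \<open>(x, y)\<close>. By \<open>zero\<close>, two terms survive on the left and one on the
    right, all with weight 1/2.\<close>
  have hadamard: "T $ (x, x) $ (x, x) = T $ (x, y) $ (x, y) + T $ (y, x) $ (x, y)"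
    if "x \<noteq> y" for x y
  proof -
    let ?V = "hadamard_on x y"
    let ?c = "?V $ x $ x * ?V $ x $ x"
    have V: "?V $ x $ x = 1 / sqrt 2" "?V $ x $ y = 1 / sqrt 2" "?V $ y $ x = 1 / sqrt 2"
      by (auto simp: hadamard_on_def that)
    have "(\<Sum>r\<in>UNIV. ?V $ x $ fst r * ?V $ x $ snd r * T $ r $ (x, y)) =
        (\<Sum>r\<in>{(x, y), (y, x)}. ?V $ x $ fst r * ?V $ x $ snd r * T $ r $ (x, y))"
      by (intro sum.mono_neutral_right) (auto intro: zero)
    also have "\<dots> = ?c * (T $ (x, y) $ (x, y) + T $ (y, x) $ (x, y))"
      using that by (simp add: V algebra_simps)
    finally have lhs: "(\<Sum>r\<in>UNIV. ?V $ x $ fst r * ?V $ x $ snd r * T $ r $ (x, y)) =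
        ?c * (T $ (x, y) $ (x, y) + T $ (y, x) $ (x, y))" .
    have "(\<Sum>r\<in>UNIV. T $ (x, x) $ r * (?V $ fst r $ x * ?V $ snd r $ y)) =
        (\<Sum>r\<in>{(x, x)}. T $ (x, x) $ r * (?V $ fst r $ x * ?V $ snd r $ y))"
      by (intro sum.mono_neutral_right) (auto intro: zero)
    also have "\<dots> = ?c * T $ (x, x) $ (x, x)"
      by (simp add: V)
    finally have "?c * (T $ (x, y) $ (x, y) + T $ (y, x) $ (x, y)) = ?c * T $ (x, x) $ (x, x)"
      using comm_nth[OF hadamard_on_unitary[OF that], of x x x y] lhs by simp
    then show ?thesis by (simp add: V)
  qed
  show ?thesis
  proof (cases "\<exists>x y :: 'n. x \<noteq> y")
    case True
    then obtain x y :: 'n where xy: "x \<noteq> y" by blast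
    define a' b' where "a' = T $ (x, y) $ (x, y)" and "b' = T $ (x, y) $ (y, x)"
    \<comment> \<open>Double transitivity carries the reference pair \<open>(x, y)\<close> to any
      pair of distinct indices.\<close>
    have a: "T $ (i, j) $ (i, j) = a'" and b: "T $ (i, j) $ (j, i) = b'" if ij: "i \<noteq> j" for i j
    proof -
      obtain \<pi> where "bij \<pi>" "\<pi> x = i" "\<pi> y = j"
        using ex_bij_pair[OF xy ij] by metis
      then show "T $ (i, j) $ (i, j) = a'" "T $ (i, j) $ (j, i) = b'"
        using perm[of \<pi> x y x y] perm[of \<pi> x y y x] by (auto simp: a'_def b'_def)
    qed
    have c: "T $ (i, i) $ (i, i) = a' + b'" for i
    proof -
      obtain j where j: "i \<noteq> j" using xy by metis
      show ?thesis using hadamard[OF j] a[OF j] b[of j i] j by simp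
    qed
    have "T = a' *\<^sub>m mat 1 + b' *\<^sub>m swap_operator"
      unfolding vec_eq_iff
    proof (intro allI)
      fix p q :: "'n \<times> 'n"
      obtain i j where p: "p = (i, j)" by (cases p)
      consider "q = (i, j)" "i \<noteq> j" | "q = (j, i)" "i \<noteq> j" | "q = (i, i)" "i = j"
        | "q \<noteq> (i, j)" "q \<noteq> (j, i)" by blast
      then show "T $ p $ q = (a' *\<^sub>m mat 1 + b' *\<^sub>m swap_operator) $ p $ q"
      proof cases
        case 1
        then show ?thesis by (simp add: p mat_nth a)
      next
        case 2
        then show ?thesis by (simp add: p mat_nth b)
      next
        case 3
        then show ?thesis by (simp add: p mat_nth c)
      next
        case 4
        obtain k l where q: "q = (k, l)" by (cases q)
        have "T $ p $ q = 0"
          unfolding p q using 4 by (intro zero) (auto simp: q)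
        moreover have "p \<noteq> q" "p \<noteq> prod.swap q"
          using 4 by (auto simp: p q)
        ultimately show ?thesis by (simp add: mat_nth)
      qed
    qed
    then show ?thesis by (rule that)
  next
    \<comment> \<open>With a single basis index, \<open>T\<close> is a 1 by 1 matrix and hence a
      multiple of the identity; any index serves as \<open>r\<close>.\<close>
    case False
    then have eq: "p = q" for p q :: "'n \<times> 'n"
      by (metis prod.collapse)
    define r where "r = (undefined :: 'n \<times> 'n)"
    have "T = (T $ r $ r) *\<^sub>m mat 1 + 0 *\<^sub>m swap_operator"
      unfolding vec_eq_iff
    proof (intro allI)
      fix p q :: "'n \<times> 'n"
      show "T $ p $ q = ((T $ r $ r) *\<^sub>m mat 1 + 0 *\<^sub>m swap_operator) $ p $ q"
        by (simp add: mat_nth eq[of p r] eq[of q r])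
    qed
    then show ?thesis by (rule that)
  qed
qed

section \<open>Haar integration\<close>

lemma entrywise_integral_nth [simp]: "entrywise_integral M f $ i $ j = (\<integral>x. f x $ i $ j \<partial>M)"
  by (simp add: entrywise_integral_def)

lemma entrywise_integral_mult_left:
  fixes f :: "'a \<Rightarrow> complex ^ 'n::finite ^ 'm::finite"
  assumes "\<And>i j. integrable M (\<lambda>x. f x $ i $ j)"
  shows "entrywise_integral M (\<lambda>x. B ** f x) = B ** entrywise_integral M f"
  by (simp add: vec_eq_iff matrix_mult_nth assms)

lemma entrywise_integral_mult_right:
  fixes f :: "'a \<Rightarrow> complex ^ 'n::finite ^ 'm::finite"
  assumes "\<And>i j. integrable M (\<lambda>x. f x $ i $ j)"
  shows "entrywise_integral M (\<lambda>x. f x ** B) = entrywise_integral M f ** B"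
  by (simp add: vec_eq_iff matrix_mult_nth assms)

lemma trace_entrywise_integral:
  assumes "\<And>i j. integrable M (\<lambda>x. f x $ i $ j)"
  shows "trace (entrywise_integral M f) = (\<integral>x. trace (f x) \<partial>M)"
  by (simp add: trace_def assms)

lemma space_haar: "normalized_haar_measure \<mu> \<Longrightarrow> space \<mu> = unitary_group"
  unfolding normalized_haar_measure_def
  by (metis sets_eq_imp_space_eq space_restrict_space2 space_restrict_space inf_top_right space_borel)

lemma borel_measurable_haar:
  fixes \<mu> :: "(complex ^ 'n::finite ^ 'n) measure" and f :: "_ \<Rightarrow> 'b::topological_space"
  assumes "normalized_haar_measure \<mu>" "continuous_on unitary_group f"
  shows "f \<in> borel_measurable \<mu>"
proof -
  have "f \<in> borel_measurable (restrict_space borel unitary_group)"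
    by (rule borel_measurable_continuous_on_restrict) fact
  moreover have "sets \<mu> = sets (restrict_space borel unitary_group)"
    using assms(1) by (simp add: normalized_haar_measure_def)
  ultimately show ?thesis
    using measurable_cong_sets by blast
qed

text \<open>A continuous function on the compact group is bounded, and a bounded measurable function
  is integrable for a probability measure.\<close>

lemma integrable_haar:
  fixes \<mu> :: "(complex ^ 'n::finite ^ 'n) measure" and f :: "_ \<Rightarrow> complex"
  assumes haar: "normalized_haar_measure \<mu>" and f: "continuous_on unitary_group f"
  shows "integrable \<mu> f"
proof -
  interpret prob_space \<mu> using haar by (simp add: normalized_haar_measure_def)
  have "bounded (f ` unitary_group)"
    by (intro compact_imp_bounded compact_continuous_image f compact_unitary_group)
  then obtain C where "\<And>U. U \<in> unitary_group \<Longrightarrow> norm (f U) \<le> C"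
    by (auto simp: bounded_iff)
  then show ?thesis
    by (intro integrable_const_bound[of _ C] AE_I2 borel_measurable_haar[OF haar f])
      (simp add: space_haar[OF haar])
qed

lemma measurable_mult_haar:
  fixes \<mu> :: "(complex ^ 'n::finite ^ 'n) measure"
  assumes haar: "normalized_haar_measure \<mu>" and V: "V \<in> unitary_group"
  shows "(\<lambda>U. V ** U) \<in> measurable \<mu> \<mu>"
proof -
  have "continuous_on unitary_group (\<lambda>U. V ** U)"
    unfolding matrix_matrix_mult_def by (intro continuous_intros)
  then have "(\<lambda>U. V ** U) \<in> borel_measurable \<mu>"
    by (rule borel_measurable_haar[OF haar])
  then have "(\<lambda>U. V ** U) \<in> measurable \<mu> (restrict_space borel unitary_group)"
    by (intro measurable_restrict_space2) (auto simp: space_haar[OF haar] unitary_mult V)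
  moreover have "sets \<mu> = sets (restrict_space borel unitary_group)"
    using haar by (simp add: normalized_haar_measure_def)
  ultimately show ?thesis
    using measurable_cong_sets by blast
qed

text \<open>Invariance is stated for images, while a push-forward measures preimages. The preimage
  under multiplication by \<open>V\<close> is the image under multiplication by
  \<open>V\<^sup>\<dagger>\<close>, so invariance is applied to
  \<open>V\<^sup>\<dagger>\<close>.\<close>

lemma distr_mult_haar:
  fixes \<mu> :: "(complex ^ 'n::finite ^ 'n) measure"
  assumes haar: "normalized_haar_measure \<mu>" and V: "V \<in> unitary_group"
  shows "distr \<mu> \<mu> (\<lambda>U. V ** U) = \<mu>"
proof (rule measure_eqI)
  fix B assume "B \<in> sets (distr \<mu> \<mu> (\<lambda>U. V ** U))"
  then have B: "B \<in> sets \<mu>" by simp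
  then have B_unitary: "B \<subseteq> unitary_group"
    using sets.sets_into_space space_haar[OF haar] by blast
  have "(\<lambda>U. V ** U) -` B \<inter> space \<mu> = (\<lambda>U. V\<^sup>\<dagger> ** U) ` B"
  proof (intro equalityI subsetI)
    fix U assume "U \<in> (\<lambda>U. V ** U) -` B \<inter> space \<mu>"
    then show "U \<in> (\<lambda>U. V\<^sup>\<dagger> ** U) ` B"
      by (intro image_eqI[of _ _ "V ** U"]) (auto simp: matrix_mul_assoc unitary_groupD V)
  next
    fix U assume "U \<in> (\<lambda>U. V\<^sup>\<dagger> ** U) ` B"
    then show "U \<in> (\<lambda>U. V ** U) -` B \<inter> space \<mu>"
      using B_unitary
      by (auto simp: matrix_mul_assoc unitary_groupD V space_haar[OF haar]
          intro!: unitary_mult conj_transpose_unitary)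
  qed
  then show "emeasure (distr \<mu> \<mu> (\<lambda>U. V ** U)) B = emeasure \<mu> B"
    using haar B conj_transpose_unitary[OF V]
    by (simp add: emeasure_distr[OF measurable_mult_haar[OF haar V]] normalized_haar_measure_def)
qed simp

lemma integral_mult_haar:
  fixes \<mu> :: "(complex ^ 'n::finite ^ 'n) measure" and f :: "_ \<Rightarrow> complex"
  assumes haar: "normalized_haar_measure \<mu>" and V: "V \<in> unitary_group"
    and f: "f \<in> borel_measurable \<mu>"
  shows "(\<integral>U. f (V ** U) \<partial>\<mu>) = (\<integral>U. f U \<partial>\<mu>)"
  using integral_distr[OF measurable_mult_haar[OF haar V] f] distr_mult_haar[OF haar V] by simp

section \<open>The twirl and its invariants\<close>

lemma continuous_on_twirl_nth:
  fixes A :: "complex ^ ('n::finite \<times> 'n) ^ ('n \<times> 'n)"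
  shows "continuous_on S (\<lambda>U. ((U \<otimes>\<^sub>m U) ** A ** (U \<otimes>\<^sub>m U)\<^sup>\<dagger>) $ p $ q)"
  unfolding matrix_mult_nth tensor_mat_nth conj_transpose_nth
  by (intro continuous_intros)

text \<open>Substituting \<open>V ** U\<close> for \<open>U\<close> conjugates the integrand by
  \<open>V \<otimes>\<^sub>m V\<close> and preserves the integral, so \<open>T\<close> is fixed by
  this conjugation.\<close>

lemma twirl_commutes:
  fixes \<mu> :: "(complex ^ 'n::finite ^ 'n) measure" and A :: "complex ^ ('n \<times> 'n) ^ ('n \<times> 'n)"
  assumes haar: "normalized_haar_measure \<mu>" and V: "V \<in> unitary_group"
  defines "T \<equiv> entrywise_integral \<mu> (\<lambda>U. (U \<otimes>\<^sub>m U) ** A ** (U \<otimes>\<^sub>m U)\<^sup>\<dagger>)"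
  shows "(V \<otimes>\<^sub>m V) ** T = T ** (V \<otimes>\<^sub>m V)"
proof -
  let ?W = "V \<otimes>\<^sub>m V" and ?X = "\<lambda>U. (U \<otimes>\<^sub>m U) ** A ** (U \<otimes>\<^sub>m U)\<^sup>\<dagger>"
  have int: "integrable \<mu> (\<lambda>U. ?X U $ p $ q)" for p q
    by (intro integrable_haar[OF haar] continuous_on_twirl_nth)
  have X: "?X (V ** U) = ?W ** ?X U ** ?W\<^sup>\<dagger>" for U
    by (simp add: tensor_mat_mult[symmetric] conj_transpose_mult matrix_mul_assoc)
  \<comment> \<open>The two constant factors leave the integral one at a time, so the
    half-multiplied integrand must be integrable as well.\<close>
  have int_left: "integrable \<mu> (\<lambda>U. (?W ** ?X U) $ p $ q)" for p q
    unfolding matrix_mult_nth[of ?W] by (intro Bochner_Integration.integrable_sum integrable_mult_right int)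
  have "T = entrywise_integral \<mu> (\<lambda>U. ?X (V ** U))"
    unfolding T_def vec_eq_iff entrywise_integral_nth
    using integral_mult_haar[OF haar V borel_measurable_integrable[OF int]] by metis
  also have "\<dots> = ?W ** T ** ?W\<^sup>\<dagger>"
    unfolding X T_def
    by (simp only: entrywise_integral_mult_right[OF int_left] entrywise_integral_mult_left[OF int])
  finally have "T ** ?W = ?W ** T ** (?W\<^sup>\<dagger> ** ?W)"
    by (metis matrix_mul_assoc)
  then show ?thesis
    by (simp add: unitary_groupD tensor_mat_unitary V)
qed

text \<open>Since \<open>B\<close> passes through the conjugation, the integrand has the constant
  trace of \<open>A ** B\<close>, and the measure has mass 1. The cases of interest are the identity
  and the swap.\<close>

lemma trace_twirl_mult:
  fixes \<mu> :: "(complex ^ 'n::finite ^ 'n) measure" and A B :: "complex ^ ('n \<times> 'n) ^ ('n \<times> 'n)"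
  assumes haar: "normalized_haar_measure \<mu>"
    and comm: "\<And>U. U \<in> unitary_group \<Longrightarrow> (U \<otimes>\<^sub>m U) ** B = B ** (U \<otimes>\<^sub>m U)"
  shows "trace (entrywise_integral \<mu> (\<lambda>U. (U \<otimes>\<^sub>m U) ** A ** (U \<otimes>\<^sub>m U)\<^sup>\<dagger>) ** B) = trace (A ** B)"
proof -
  interpret prob_space \<mu> using haar by (simp add: normalized_haar_measure_def)
  let ?X = "\<lambda>U. (U \<otimes>\<^sub>m U) ** A ** (U \<otimes>\<^sub>m U)\<^sup>\<dagger>"
  have int: "integrable \<mu> (\<lambda>U. ?X U $ p $ q)" for p q
    by (intro integrable_haar[OF haar] continuous_on_twirl_nth)
  have int_right: "integrable \<mu> (\<lambda>U. (?X U ** B) $ p $ q)" for p q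
    unfolding matrix_mult_nth[of _ B] by (intro Bochner_Integration.integrable_sum integrable_mult_left int)
  have "trace (?X U ** B) = trace (A ** B)" if U: "U \<in> space \<mu>" for U
  proof -
    let ?W = "U \<otimes>\<^sub>m U"
    have "U \<in> unitary_group" using U by (simp add: space_haar[OF haar])
    \<comment> \<open>The commutation hypothesis at \<open>U\<^sup>\<dagger>\<close> is what moves
      \<open>B\<close> past the right-hand factor.\<close>
    then have W: "?W \<in> unitary_group" and "U\<^sup>\<dagger> \<in> unitary_group"
      by (auto intro: tensor_mat_unitary conj_transpose_unitary)
    then have "?W\<^sup>\<dagger> ** B = B ** ?W\<^sup>\<dagger>"
      using comm by (simp add: conj_transpose_tensor_mat)
    then have "?X U ** B = ?W ** (A ** B) ** ?W\<^sup>\<dagger>"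
      by (simp flip: matrix_mul_assoc)
    then show ?thesis using trace_unitary_conj[OF W] by simp
  qed
  then have "(\<integral>U. trace (?X U ** B) \<partial>\<mu>) = (\<integral>U. trace (A ** B) \<partial>\<mu>)"
    by (intro Bochner_Integration.integral_cong) auto
  then have "trace (entrywise_integral \<mu> (\<lambda>U. ?X U ** B)) = trace (A ** B)"
    by (simp add: trace_entrywise_integral[OF int_right] prob_space)
  then show ?thesis
    unfolding entrywise_integral_mult_right[OF int] .
qed

section \<open>Solving for the two coefficients\<close>

theorem proposition3p9:
  fixes \<mu> :: "(complex ^ 'n ^ 'n) measure"
    and A :: "complex ^ ('n::finite \<times> 'n) ^ ('n \<times> 'n)"
    and F :: "complex ^ ('n::finite \<times> 'n) ^ ('n \<times> 'n)"
    and d :: complex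
  defines "F \<equiv> swap_operator"
    and "d \<equiv> of_nat CARD('n)"
  assumes "CARD('n) \<ge> 2"
    and "normalized_haar_measure \<mu>"
  shows "entrywise_integral \<mu> (\<lambda>U. (U \<otimes>\<^sub>m U) ** A ** (U \<otimes>\<^sub>m U)\<^sup>\<dagger>) =
    (trace A / (d\<^sup>2 - 1) - trace (A ** F) / (d * (d\<^sup>2 - 1))) *\<^sub>m mat 1
    - (trace A / (d * (d\<^sup>2 - 1)) - trace (A ** F) / (d\<^sup>2 - 1)) *\<^sub>m F"
proof -
  let ?T = "entrywise_integral \<mu> (\<lambda>U. (U \<otimes>\<^sub>m U) ** A ** (U \<otimes>\<^sub>m U)\<^sup>\<dagger>)"
  note haar = \<open>normalized_haar_measure \<mu>\<close>
  obtain a b where T: "?T = a *\<^sub>m mat 1 + b *\<^sub>m F"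
    unfolding F_def by (rule commutant_tensor_square[OF twirl_commutes[OF haar]])
  \<comment> \<open>The swap is an involution, so multiplying by \<open>F\<close> exchanges the
    roles of \<open>a\<close> and \<open>b\<close>.\<close>
  have TF: "?T ** F = a *\<^sub>m F + b *\<^sub>m mat 1"
    unfolding T F_def vec_eq_iff
    by (simp add: mult_swap_operator_nth mat_nth)
  have trace_one: "trace (mat 1 :: complex ^ ('n \<times> 'n) ^ ('n \<times> 'n)) = d\<^sup>2"
    by (simp add: trace_mat_one d_def power2_eq_square)
  have trace_F: "trace F = d"
    by (simp add: F_def d_def trace_swap_operator)
  have "trace A = trace ?T"
    using trace_twirl_mult[OF haar, of "mat 1" A] by simp
  then have tr: "trace A = a * d\<^sup>2 + b * d"
    by (simp add: T trace_add_smult trace_one trace_F)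
  have "trace (A ** F) = trace (?T ** F)"
    unfolding F_def by (rule trace_twirl_mult[OF haar, symmetric]) (simp add: swap_operator_commutes_tensor)
  then have tr_F: "trace (A ** F) = a * d + b * d\<^sup>2"
    by (simp add: TF trace_add_smult trace_one trace_F)
  \<comment> \<open>The linear system for \<open>a\<close> and \<open>b\<close> has determinant d^2
    (d^2 - 1), which is nonzero for d at least 2.\<close>
  have d0: "d \<noteq> 0" using \<open>CARD('n) \<ge> 2\<close> by (simp add: d_def)
  have "d\<^sup>2 \<noteq> 1"
  proof
    assume "d\<^sup>2 = 1"
    then have "CARD('n)\<^sup>2 = 1"
      unfolding d_def by (metis of_nat_1 of_nat_eq_iff of_nat_power)
    then show False using \<open>CARD('n) \<ge> 2\<close> by simp
  qed
  then have d1: "d\<^sup>2 - 1 \<noteq> 0" by simp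
  have a: "trace A / (d\<^sup>2 - 1) - trace (A ** F) / (d * (d\<^sup>2 - 1)) = a"
  proof -
    have "trace A / (d\<^sup>2 - 1) - trace (A ** F) / (d * (d\<^sup>2 - 1)) =
        (d * trace A - trace (A ** F)) / (d * (d\<^sup>2 - 1))"
      using d0 d1 by (simp add: diff_divide_distrib)
    \<comment> \<open>This combination of the two trace equations eliminates
      \<open>b\<close>.\<close>
    also have "d * trace A - trace (A ** F) = a * (d * (d\<^sup>2 - 1))"
      unfolding tr tr_F by algebra
    finally show ?thesis using d0 d1 by simp
  qed
  \<comment> \<open>The sign is negative because the claimed formula subtracts the \<open>F\<close>
    term; here \<open>a\<close> is eliminated.\<close>
  have b: "trace A / (d * (d\<^sup>2 - 1)) - trace (A ** F) / (d\<^sup>2 - 1) = - b"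
  proof -
    have "trace A / (d * (d\<^sup>2 - 1)) - trace (A ** F) / (d\<^sup>2 - 1) =
        (trace A - d * trace (A ** F)) / (d * (d\<^sup>2 - 1))"
      using d0 d1 by (simp add: diff_divide_distrib)
    also have "trace A - d * trace (A ** F) = - b * (d * (d\<^sup>2 - 1))"
      unfolding tr tr_F by algebra
    finally show ?thesis using d0 d1 by simp
  qed
  show ?thesis
    unfolding a b T by (simp add: vec_eq_iff)
qed

end
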